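(* Let $\varphi$ be the $7$-uniform morphism on the alphabet $\mathbb{Z}_{\geq 0}$ defined by $\varphi(n) = 0\,0\,0\,0\,1\,0\,(n + 1)$ for all $n \in \mathbb{Z}_{\geq 0}$. Then $\textbf{w}_{5/3} = \varphi^\infty(0)$.
   Context: Words are finite or infinite sequences of letters, indexed from position $0$; a factor is a contiguous subword. Let $a, b$ be relatively prime positive integers. For a nonempty word $v$ whose length is divisible by $b$, define $v^{a/b} = v^{\lfloor a/b \rfloor} v_0 v_1 \cdots v_{t-1}$, where $t = |v|\,(a/b - \lfloor a/b\rfloor)$ (so $|v^{a/b}| = \frac{a}{b}|v|$); such a word is called an $\frac{a}{b}$-power. A word is $\frac{a}{b}$-power-free if none of its factors is an $\frac{a}{b}$-power. For $\frac{a}{b} > 1$, $\textbf{w}_{a/b}$ denotes the lexicographically least infinite word over the alphabet $\mathbb{Z}_{\geq 0}$ (with its usual order) that is $\frac{a}{b}$-power-free. A morphism $\varphi$ on an alphabet $\Sigma$ is a map $\Sigma \to \Sigma^*$, extended to words by concatenation; it is $k$-uniform if $|\varphi(c)| = k$ for every letter $c$. If $\varphi(c)$ begins with the letter $c$, $\varphi^\infty(c)$ denotes the infinite word beginning with $c$ that is the limit of $\varphi^i(c)$ (a fixed point of $\varphi$). *)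

theory Defs
  imports Complex_Main "HOL-Library.Omega_Words_Fun" "HOL-Library.Fun_Lexorder"
begin

text \<open>
  Infinite words are functions on the natural numbers (type \<open>'a word\<close> of
  \<open>Omega_Words_Fun\<close>), finite words are lists; \<open>w [i \<rightarrow> j]\<close> is the
  factor of \<open>w\<close> on positions \<open>i, \<dots>, j - 1\<close>. The alphabet of nonnegative
  integers is the type \<open>nat\<close>.
\<close>

section \<open>Fractional powers\<close>

text \<open>
  The exponent \<open>a/b\<close> is given by its numerator and denominator, which are meant
  to be positive and coprime. Then \<open>a div b\<close> is the floor of \<open>a/b\<close>, and
  \<open>a mod b\<close> is \<open>b\<close> times its fractional part, so that the \<open>take\<close> below
  has length \<open>|v| (a/b - floor (a/b))\<close>; see the two lemmas that follow.
\<close>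

definition frac_power :: "nat \<Rightarrow> nat \<Rightarrow> 'a list \<Rightarrow> 'a list" where
  "frac_power a b v =
     concat (replicate (a div b) v) @ take (length v * (a mod b) div b) v"

lemma frac_power_remainder:
  assumes "b > 0" "b dvd length v"
  shows "real (length v * (a mod b) div b) =
         real (length v) * (real a / real b - real_of_int \<lfloor>real a / real b\<rfloor>)"
proof -
  obtain m where m: "length v = b * m" using assms(2) by blast
  have "real a = real (a div b) * real b + real (a mod b)"
    by (metis div_mult_mod_eq of_nat_add of_nat_mult)
  then have "real (a mod b) = real b * (real a / real b - real (a div b))"
    using assms(1) by (simp add: field_simps)
  moreover have "\<lfloor>real a / real b\<rfloor> = int (a div b)"
    by (simp add: floor_divide_of_nat_eq)
  moreover have "length v * (a mod b) div b = m * (a mod b)"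
    using assms(1) m by (simp add: mult.assoc)
  ultimately show ?thesis using m by (simp add: mult.assoc mult.left_commute)
qed

lemma length_frac_power:
  assumes "b > 0" "b dvd length v"
  shows "b * length (frac_power a b v) = a * length v"
proof -
  obtain m where m: "length v = b * m" using assms(2) by blast
  have "m * (a mod b) \<le> b * m"
    using mod_less_divisor[OF assms(1), of a] by (subst mult.commute) (intro mult_le_mono1, simp)
  moreover have "length v * (a mod b) div b = m * (a mod b)"
    using assms(1) m by (simp add: mult.assoc)
  ultimately have "length (frac_power a b v) = (a div b) * (b * m) + (a mod b) * m"
    using m by (simp add: frac_power_def length_concat sum_list_replicate min_absorb2 mult.commute)
  also have "\<dots> = ((a div b) * b + a mod b) * m" by (simp only: algebra_simps)
  finally show ?thesis using m by simp
qed

definition is_power :: "nat \<Rightarrow> nat \<Rightarrow> 'a list \<Rightarrow> bool" where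
  "is_power a b u \<longleftrightarrow> (\<exists>v. v \<noteq> [] \<and> b dvd length v \<and> u = frac_power a b v)"

definition power_free :: "nat \<Rightarrow> nat \<Rightarrow> 'a word \<Rightarrow> bool" where
  "power_free a b w \<longleftrightarrow> (\<forall>i j. i \<le> j \<longrightarrow> \<not> is_power a b (w [i \<rightarrow> j]))"

section \<open>The lexicographically least power-free word\<close>

definition is_lex_least :: "(nat word \<Rightarrow> bool) \<Rightarrow> nat word \<Rightarrow> bool" where
  "is_lex_least P w \<longleftrightarrow> P w \<and> (\<forall>x. P x \<longrightarrow> w = x \<or> less_fun w x)"

definition least_power_free_word :: "nat \<Rightarrow> nat \<Rightarrow> nat word" where
  "least_power_free_word a b = (THE w. is_lex_least (power_free a b) w)"

lemma is_lex_least_unique: "is_lex_least P w \<Longrightarrow> is_lex_least P x \<Longrightarrow> w = x"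
  unfolding is_lex_least_def using less_fun_asym by blast

lemma map_upt_eqD: "map x [0..<n] = map y [0..<n] \<Longrightarrow> k < n \<Longrightarrow> x k = y k"
  by simp

lemma ex_is_lex_least:
  assumes ne: "P y0"
    and closed: "\<And>x. (\<And>n. \<exists>y. P y \<and> map y [0..<n] = map x [0..<n]) \<Longrightarrow> P x"
  shows "\<exists>w. is_lex_least P w"
proof -
  define g where "g l = (LEAST a. \<exists>y. P y \<and> map y [0..<Suc (length l)] = l @ [a])" for l
  define f where "f n = ((\<lambda>l. l @ [g l]) ^^ n) []" for n
  define w where "w n = g (f n)" for n
  have f_Suc: "f (Suc n) = f n @ [w n]" for n by (simp add: f_def w_def)
  have f_eq: "f n = map w [0..<n]" for n
    by (induction n) (simp_all add: f_Suc, simp add: f_def)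
  have least: "(\<exists>y. P y \<and> map y [0..<Suc n] = map w [0..<Suc n])"
    "w n \<le> z n" if "P z" "map z [0..<n] = map w [0..<n]" for z n
  proof -
    have wn: "w n = (LEAST a. \<exists>y. P y \<and> map y [0..<Suc n] = map w [0..<n] @ [a])"
      unfolding w_def[of n] g_def f_eq by simp
    have "\<exists>y. P y \<and> map y [0..<Suc n] = map w [0..<n] @ [z n]"
      using that by (intro exI[of _ z]) simp
    from LeastI[of "\<lambda>a. \<exists>y. P y \<and> map y [0..<Suc n] = map w [0..<n] @ [a]", OF this]
      Least_le[of "\<lambda>a. \<exists>y. P y \<and> map y [0..<Suc n] = map w [0..<n] @ [a]", OF this]
    show "(\<exists>y. P y \<and> map y [0..<Suc n] = map w [0..<Suc n])" "w n \<le> z n"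
      unfolding wn[symmetric] by auto
  qed
  have ext: "\<exists>y. P y \<and> map y [0..<n] = map w [0..<n]" for n
  proof (induction n)
    case 0
    show ?case using ne by auto
  next
    case (Suc n)
    then show ?case using least(1) by blast
  qed
  have "P w" using closed ext by blast
  moreover have "w = x \<or> less_fun w x" if "P x" for x
  proof (cases "w = x")
    case False
    then have ex: "\<exists>k. w k \<noteq> x k" by auto
    define k where "k = (LEAST k. w k \<noteq> x k)"
    have k: "w k \<noteq> x k" unfolding k_def by (rule LeastI_ex[OF ex])
    have below: "w j = x j" if "j < k" for j
      using not_less_Least[of j "\<lambda>k. w k \<noteq> x k"] that unfolding k_def by blast
    have "map x [0..<k] = map w [0..<k]" using below by simp
    from least(2)[OF \<open>P x\<close> this] k have "w k < x k" by simp
    then show ?thesis using below by (auto simp: less_fun_def)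
  qed simp
  ultimately show ?thesis unfolding is_lex_least_def by blast
qed

lemma power_free_id:
  assumes "b > 0" "a > b"
  shows "power_free a b (id :: nat word)"
  unfolding power_free_def
proof (intro allI impI notI)
  fix i j :: nat
  assume "i \<le> j" "is_power a b (id [i \<rightarrow> j])"
  then obtain v :: "nat list" where v: "v \<noteq> []" "b dvd length v"
    and eq: "id [i \<rightarrow> j] = frac_power a b v" by (auto simp: is_power_def)
  let ?c = "concat (replicate (a div b - 1) v) @ take (length v * (a mod b) div b) v"
  have "a div b \<ge> 1" using assms by (simp add: Suc_le_eq div_greater_zero_iff)
  then have split: "frac_power a b v = v @ ?c"
    unfolding frac_power_def by (cases "a div b") auto
  have "b * length v < b * length (frac_power a b v)"
    unfolding length_frac_power[OF assms(1) v(2)] using assms(2) v(1) by simp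
  then have "?c \<noteq> []" using split by (metis append_Nil2 less_irrefl)
  moreover have "set ?c \<subseteq> set v" using set_take_subset[of _ v] by auto
  ultimately have "set v \<inter> set ?c \<noteq> {}" by (metis inf.absorb2 set_empty)
  then have "\<not> distinct (v @ ?c)" by (simp only: distinct_append) blast
  moreover have "distinct (id [i \<rightarrow> j])" by (simp add: subsequence_def)
  ultimately show False using eq split by simp
qed

lemma power_free_closed:
  assumes "\<And>n. \<exists>y. power_free a b y \<and> map y [0..<n] = map x [0..<n]"
  shows "power_free a b x"
  unfolding power_free_def
proof (intro allI impI)
  fix i j :: nat
  assume "i \<le> j"
  obtain y where y: "power_free a b y" "map y [0..<j] = map x [0..<j]" using assms by blast
  have "y [i \<rightarrow> j] = x [i \<rightarrow> j]" using y(2) by (simp add: subsequence_def)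
  with y(1) \<open>i \<le> j\<close> show "\<not> is_power a b (x [i \<rightarrow> j])" by (metis power_free_def)
qed

text \<open>For \<open>a/b > 1\<close> the definite description above is proper.\<close>

theorem is_lex_least_least_power_free_word:
  assumes "b > 0" "a > b"
  shows "is_lex_least (power_free a b) (least_power_free_word a b)"
proof -
  have "\<exists>w. is_lex_least (power_free a b) w"
    by (rule ex_is_lex_least[where P = "power_free a b", OF power_free_id[OF assms]]) (rule power_free_closed)
  then show ?thesis
    unfolding least_power_free_word_def using is_lex_least_unique by (metis theI)
qed

section \<open>Morphisms and their fixed points\<close>

text \<open>A morphism is given by the images of the letters.\<close>

definition morph_ext :: "('a \<Rightarrow> 'a list) \<Rightarrow> 'a list \<Rightarrow> 'a list" where
  "morph_ext \<phi> u = concat (map \<phi> u)"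

definition word_tendsto :: "(nat \<Rightarrow> 'a list) \<Rightarrow> 'a word \<Rightarrow> bool" where
  "word_tendsto u x \<longleftrightarrow> (\<forall>n. \<forall>\<^sub>F i in sequentially. n < length (u i) \<and> u i ! n = x n)"

definition morph_limit :: "('a \<Rightarrow> 'a list) \<Rightarrow> 'a \<Rightarrow> 'a word" where
  "morph_limit \<phi> c = (THE x. word_tendsto (\<lambda>i. (morph_ext \<phi> ^^ i) [c]) x)"

lemma word_tendsto_unique:
  assumes "word_tendsto u x" "word_tendsto u y"
  shows "x = y"
proof
  fix n
  have "\<forall>\<^sub>F i in sequentially. x n = y n"
    using assms[unfolded word_tendsto_def, rule_format, of n] by eventually_elim simp
  then show "x n = y n" by simp
qed

text \<open>
  For a \<open>k\<close>-uniform morphism with \<open>k \<ge> 2\<close> whose image of \<open>c\<close> begins with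
  \<open>c\<close>, the limit exists and begins with \<open>c\<close>.
\<close>

theorem morph_limit:
  assumes unif: "\<And>d. length (\<phi> d) = k" and k: "k \<ge> 2" and hd: "hd (\<phi> c) = c"
  shows "word_tendsto (\<lambda>i. (morph_ext \<phi> ^^ i) [c]) (morph_limit \<phi> c)"
    and "morph_limit \<phi> c 0 = c"
proof -
  let ?u = "\<lambda>i. (morph_ext \<phi> ^^ i) [c]"
  have len_ext: "length (morph_ext \<phi> l) = k * length l" for l
    by (induction l) (simp_all add: morph_ext_def unif)
  have len: "length (?u i) = k ^ i" for i
    by (induction i) (simp_all add: len_ext)
  have step: "\<exists>r. ?u (Suc i) = ?u i @ r" for i
  proof (induction i)
    case 0
    have "\<phi> c \<noteq> []" using unif[of c] k by auto
    then have "\<phi> c = [c] @ tl (\<phi> c)" using hd by (metis append_Cons append_Nil list.collapse)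
    then show ?case by (auto simp: morph_ext_def)
  next
    case (Suc i)
    then obtain r where "?u (Suc i) = ?u i @ r" by blast
    then have "?u (Suc (Suc i)) = morph_ext \<phi> (?u i @ r)" by simp
    also have "\<dots> = ?u (Suc i) @ morph_ext \<phi> r" by (simp add: morph_ext_def)
    finally show ?case by blast
  qed
  have mono: "\<exists>r. ?u (i + m) = ?u i @ r" for i m
  proof (induction m)
    case (Suc m)
    then show ?case using step[of "i + m"] by (metis add_Suc_right append_assoc)
  qed simp
  have big: "n < k ^ i" if "n \<le> i" for n i
  proof -
    have "n < 2 ^ n" by (rule less_exp)
    also have "(2::nat) ^ n \<le> k ^ n" using k by (rule power_mono) simp
    also have "k ^ n \<le> k ^ i" using that k by (intro power_increasing) auto
    finally show ?thesis .
  qed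
  have lim: "word_tendsto ?u (\<lambda>n. ?u n ! n)"
    unfolding word_tendsto_def
  proof (intro allI eventually_sequentiallyI conjI)
    fix n i :: nat
    assume "n \<le> i"
    then show "n < length (?u i)" using big len by simp
    obtain r where "?u i = ?u n @ r" using mono[of n "i - n"] \<open>n \<le> i\<close> by auto
    then show "?u i ! n = ?u n ! n" using big[of n n] len[of n] by (simp add: nth_append)
  qed
  then have "morph_limit \<phi> c = (\<lambda>n. ?u n ! n)"
    unfolding morph_limit_def using word_tendsto_unique by blast
  then show "word_tendsto ?u (morph_limit \<phi> c)" "morph_limit \<phi> c 0 = c"
    using lim by simp_all
qed

end

theory Submission
  imports Defs
begin

text \<open>
  Let \<open>w\<close> be the fixed point. A \<open>5/3\<close>-power is a factor of length \<open>5m\<close> with period \<open>3m\<close>.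
  If \<open>7\<close> does not divide \<open>m\<close>, then the positions of the nonzero letters, which are those
  congruent to \<open>4\<close> or \<open>6\<close> modulo \<open>7\<close>, rule out such a factor in \<open>w\<close>; if \<open>7\<close> divides \<open>m\<close>,
  then the letters at positions congruent to \<open>6\<close> form a shorter \<open>5/3\<close>-power in \<open>w\<close>.
  For minimality, decrease a nonzero letter of \<open>w\<close> to \<open>c\<close>. For \<open>c = 0\<close> the prefix
  that ends there has the suffix \<open>00000\<close> or \<open>00100\<close>. For \<open>c > 0\<close> the
  letter is \<open>w q + 1\<close> at position \<open>7q + 6\<close>, and the image under the morphism of the power
  that arises by decreasing \<open>w q\<close> to \<open>c - 1\<close> is the required power.
\<close>

section \<open>Powers with exponent strictly between 1 and 2\<close>

text \<open>Here \<open>a div b = 1\<close> and \<open>a mod b = a - b\<close>, so for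
  \<open>length v = b * m\<close> the power is \<open>v\<close> followed by its prefix of length
  \<open>(a - b) * m\<close>, which amounts to a period condition.\<close>

lemma is_power_subsequence_iff:
  assumes "b < a" "a < 2 * b"
  shows "is_power a b (w [i \<rightarrow> j]) \<longleftrightarrow>
    (\<exists>m>0. j = i + a * m \<and> (\<forall>k<(a - b) * m. w (i + k) = w (i + k + b * m)))"
    (is "?L \<longleftrightarrow> ?R")
proof -
  have b: "b > 0" and a: "a = b + (a - b)" using assms by auto
  have ab: "a div b = 1" "a mod b = a - b"
    using assms by (simp_all add: div_nat_eqI mod_if)
  have fp: "frac_power a b v = v @ take ((a - b) * m) v" if "length v = b * m" for v :: "'a list" and m
    using that b by (simp add: frac_power_def ab mult_ac)
  have am: "a * m = b * m + (a - b) * m" for m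
    using a by (metis add_mult_distrib)
  have short: "(a - b) * m \<le> b * m" for m
    using assms by (intro mult_le_mono1) simp
  show ?thesis
  proof
    assume ?L
    then obtain v where v: "v \<noteq> []" "b dvd length v" "w [i \<rightarrow> j] = frac_power a b v"
      by (auto simp: is_power_def)
    then obtain m where m: "length v = b * m" by blast
    have "m > 0" using m v(1) by (cases m) auto
    have eq: "w [i \<rightarrow> j] = v @ take ((a - b) * m) v" using v(3) fp[OF m] by simp
    have "j - i = a * m"
      using arg_cong[OF eq, of length] m short[of m] am[of m] by simp
    moreover have "a * m > 0" using \<open>m > 0\<close> assms by simp
    ultimately have j: "j = i + a * m" by linarith
    have "w (i + k) = w (i + k + b * m)" if k: "k < (a - b) * m" for k
    proof -
      have kb: "k < b * m" using k short[of m] by linarith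
      have "w (i + k) = (w [i \<rightarrow> j]) ! k" "w (i + k + b * m) = (w [i \<rightarrow> j]) ! (b * m + k)"
        using k j am[of m] by (simp_all add: subsequence_def add_ac)
      then show ?thesis using kb k m by (simp add: eq nth_append)
    qed
    then show ?R using \<open>m > 0\<close> j by blast
  next
    assume ?R
    then obtain m where m: "m > 0" "j = i + a * m"
      and per: "\<And>k. k < (a - b) * m \<Longrightarrow> w (i + k) = w (i + k + b * m)" by blast
    let ?v = "w [i \<rightarrow> i + b * m]"
    have len: "length ?v = b * m" by simp
    have "w [i \<rightarrow> j] = ?v @ take ((a - b) * m) ?v"
    proof (rule nth_equalityI)
      show "length (w [i \<rightarrow> j]) = length (?v @ take ((a - b) * m) ?v)"
        using short[of m] am[of m] m by simp
      fix k assume "k < length (w [i \<rightarrow> j])"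
      then have k: "k < b * m + (a - b) * m" using am[of m] m by simp
      show "(w [i \<rightarrow> j]) ! k = (?v @ take ((a - b) * m) ?v) ! k"
      proof (cases "k < b * m")
        case True
        then show ?thesis using k m am[of m] by (simp add: nth_append subsequence_def)
      next
        case False
        then obtain l where l: "k = b * m + l" using le_Suc_ex not_less by blast
        have "l < (a - b) * m" using k l by simp
        moreover from this have "l < b * m" using short[of m] by linarith
        ultimately show ?thesis
          using l m am[of m] per[of l] by (simp add: nth_append subsequence_def add_ac)
      qed
    qed
    then show ?L
      using fp[OF len] len m(1) b unfolding is_power_def
      by (intro exI[of _ ?v]) (auto simp del: subsequence_length)
  qed
qed

lemma power_free_iff:
  assumes "b < a" "a < 2 * b"
  shows "power_free a b w \<longleftrightarrow>
    (\<forall>i. \<forall>m>0. \<exists>k<(a - b) * m. w (i + k) \<noteq> w (i + k + b * m))"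
  unfolding power_free_def is_power_subsequence_iff[OF assms] by (metis le_add1)

section \<open>Fixed points of uniform morphisms\<close>

lemma nth_morph_ext:
  assumes "\<And>c. length (\<phi> c) = k" "q < length u" "r < k"
  shows "morph_ext \<phi> u ! (k * q + r) = \<phi> (u ! q) ! r"
  using assms(2)
proof (induction u arbitrary: q)
  case (Cons c u)
  then show ?case
    using assms(1,3) by (cases q) (simp_all add: morph_ext_def nth_append add.assoc)
qed simp

text \<open>Letter \<open>k * q + r\<close> of iterate \<open>i + 1\<close> is letter
  \<open>r\<close> of the image of letter \<open>q\<close> of iterate \<open>i\<close>, and both
  letters eventually agree with the limit.\<close>

lemma morph_limit_fixed_point:
  assumes unif: "\<And>d. length (\<phi> d) = k" and k: "k \<ge> 2" and hd: "hd (\<phi> c) = c" and r: "r < k"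
  shows "morph_limit \<phi> c (k * q + r) = \<phi> (morph_limit \<phi> c q) ! r"
proof -
  let ?u = "\<lambda>i. (morph_ext \<phi> ^^ i) [c]" and ?x = "morph_limit \<phi> c"
  have ev: "\<forall>\<^sub>F i in sequentially. n < length (?u i) \<and> ?u i ! n = ?x n" for n
    using morph_limit(1)[where \<phi> = \<phi>, OF unif k hd] unfolding word_tendsto_def by blast
  have "\<forall>\<^sub>F i in sequentially. ?u (Suc i) ! (k * q + r) = ?x (k * q + r)"
    using ev[of "k * q + r"] eventually_sequentially_Suc[of "\<lambda>i. ?u i ! (k * q + r) = ?x (k * q + r)"]
    by (auto elim: eventually_mono)
  with ev[of q] have "\<forall>\<^sub>F i in sequentially. ?x (k * q + r) = \<phi> (?x q) ! r"
  proof eventually_elim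
    case (elim i)
    then show ?case using nth_morph_ext[of \<phi> k q "?u i" r, OF unif _ r] by simp
  qed
  then show ?thesis by simp
qed

text \<open>The combinatorics rests on this recursion alone; the limit returns only in the final
  interpretation.\<close>

locale word_five_thirds =
  fixes w :: "nat word"
  assumes w_rec: "r < 7 \<Longrightarrow> w (7 * q + r) = [0, 0, 0, 0, 1, 0, w q + 1] ! r"
begin

lemma w_block:
  "w (7 * q) = 0" "w (7 * q + 1) = 0" "w (7 * q + 2) = 0" "w (7 * q + 3) = 0"
  "w (7 * q + 4) = 1" "w (7 * q + 5) = 0" "w (7 * q + 6) = w q + 1"
  using w_rec[of 0 q] w_rec[of 1 q] w_rec[of 2 q] w_rec[of 3 q] w_rec[of 4 q] w_rec[of 5 q]
    w_rec[of 6 q]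
  by simp_all

lemma w_eq_0_iff: "w n = 0 \<longleftrightarrow> n mod 7 \<noteq> 4 \<and> n mod 7 \<noteq> 6"
proof -
  have "[0, 0, 0, 0, 1, 0, x + 1] ! r = 0 \<longleftrightarrow> r \<noteq> 4 \<and> r \<noteq> 6" if "r < 7" for r x :: nat
    using that by (auto simp: less_Suc_eq numeral_eq_Suc)
  moreover have "w (7 * (n div 7) + n mod 7) = [0, 0, 0, 0, 1, 0, w (n div 7) + 1] ! (n mod 7)"
    by (rule w_rec) simp
  ultimately show ?thesis by simp
qed

lemma w_shift_cong:
  assumes "n mod 7 \<noteq> 6"
  shows "w (n + 7 * d) = w n"
proof -
  have "n mod 7 < 6" using assms mod_less_divisor[of 7 n] by linarith
  moreover have "[0, 0, 0, 0, 1, 0, x] ! r = [0, 0, 0, 0, 1, 0, y] ! r" if "r < 6"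
    for r x y :: nat
    using that by (auto simp: less_Suc_eq numeral_eq_Suc)
  ultimately have "w (7 * (n div 7 + d) + n mod 7) = w (7 * (n div 7) + n mod 7)"
    by (metis mod_less_divisor w_rec zero_less_numeral)
  moreover have "7 * (n div 7 + d) + n mod 7 = n + 7 * d" by presburger
  ultimately show ?thesis by simp
qed

section \<open>Power-freeness of the fixed point\<close>

lemma ex_mismatch:
  assumes "m > 0"
  shows "\<exists>k<2 * m. w (i + k) \<noteq> w (i + k + 3 * m)"
  using assms
proof (induction m arbitrary: i rule: less_induct)
  case (less m)
  show ?case
  proof (rule ccontr)
    assume "\<not> ?thesis"
    then have per: "w (i + k) = w (i + k + 3 * m)" if "k < 2 * m" for k using that by blast
    then have zero: "w (i + k) = 0 \<longleftrightarrow> w (i + k + 3 * m) = 0" if "k < 2 * m" for k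
      using that by simp
    show False
    proof (cases "7 dvd m")
      case True
      then obtain l where l: "m = 7 * l" by blast
      \<comment> \<open>Position \<open>i\<close> lies in block \<open>q\<close>, so the last
        letters of the blocks \<open>q\<close>, ..., \<open>q + 2 * l - 1\<close> all lie among the
        \<open>2 * m = 14 * l\<close> positions from \<open>i\<close> on.\<close>
      define q where "q = i div 7"
      have q: "7 * q \<le> i" "i < 7 * q + 7" unfolding q_def by (simp, presburger)
      have "w (q + k) = w (q + k + 3 * l)" if "k < 2 * l" for k
      proof -
        let ?n = "7 * (q + k) + 6"
        have "i \<le> ?n" using q by simp
        moreover have "?n < i + 2 * m" using that l q by simp

        ultimately have "w ?n = w (?n + 3 * m)" using per[of "?n - i"] by simp
        also have "?n + 3 * m = 7 * (q + k + 3 * l) + 6" using l by simp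
        finally show ?thesis by (simp only: w_block)
      qed
      then show False using less.IH[of l q] less.prems l by auto
    next
      case False
      define r where "r = i mod 7"
      have "r < 7" unfolding r_def by simp
      then have r: "r \<in> {0, 1, 2, 3, 4, 5, 6}" by auto
      have zero_mod: "(r + k) mod 7 \<in> {4, 6} \<longleftrightarrow> (r + k + 3 * m) mod 7 \<in> {4, 6}"
        if "k < 2 * m" for k
        using zero[OF that] unfolding w_eq_0_iff r_def by (simp add: mod_simps add.assoc) blast
      \<comment> \<open>For \<open>m \<ge> 4\<close> the \<open>2 * m\<close> compared positions
        meet every residue modulo 7; the smaller \<open>m\<close> are checked for each
        \<open>r\<close>.\<close>
      have "m = 1 \<or> m = 2 \<or> m = 3 \<or> m \<ge> 4" using less.prems by linarith
      then show False
      proof (elim disjE)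
        assume "m = 1"
        then show False
          using r zero_mod[of 0] zero_mod[of 1] unfolding insert_iff empty_iff
          by (elim disjE) simp_all
      next
        assume "m = 2"
        then show False
          using r zero_mod[of 0] zero_mod[of 1] zero_mod[of 2] zero_mod[of 3]
          unfolding insert_iff empty_iff by (elim disjE) simp_all
      next
        assume "m = 3"
        then show False
          using r zero_mod[of 0] zero_mod[of 1] zero_mod[of 2] zero_mod[of 3] zero_mod[of 4]
            zero_mod[of 5]
          unfolding insert_iff empty_iff by (elim disjE) simp_all
      next
        assume "m \<ge> 4"
        have shift: "(c + 3 * m) mod 7 \<in> {4, 6}" if "c \<in> {4, 6}" for c
        proof -
          \<comment> \<open>As 6 is -1 modulo 7, this solves \<open>r + k = c\<close> modulo
            7.\<close>
          define k where "k = (c + 6 * r) mod 7"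
          have "k < 7" unfolding k_def by simp
          then have "k < 2 * m" using \<open>m \<ge> 4\<close> by linarith
          moreover have "(r + k) mod 7 = c" using r that unfolding k_def by auto
          moreover from this have "(r + k + 3 * m) mod 7 = (c + 3 * m) mod 7"
            by (metis mod_add_left_eq)
          ultimately show ?thesis using zero_mod[of k] that by simp
        qed
        have "(4 + 3 * m) mod 7 = 4 \<or> (4 + 3 * m) mod 7 = 6"
          "(6 + 3 * m) mod 7 = 4 \<or> (6 + 3 * m) mod 7 = 6"
          using shift[of 4] shift[of 6] by simp_all
        \<comment> \<open>Moving 4 to 6 would need \<open>3 * m = 2\<close> modulo 7, which moves 6
          to 1. So 4 stays fixed, and 7 divides \<open>3 * m\<close>, hence
          \<open>m\<close>.\<close>
        then show False using False by presburger
      qed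
    qed
  qed
qed

section \<open>Lexicographic minimality\<close>

text \<open>The power ends at position \<open>n\<close>, where \<open>c\<close> replaces the letter \<open>w n\<close>.\<close>

lemma ex_power_of_less:
  assumes "c < w n"
  shows "\<exists>m>0. 5 * m \<le> n + 1 \<and> w (n - 3 * m) = c \<and>
    (\<forall>j. 0 < j \<and> j < 2 * m \<longrightarrow> w (n - j) = w (n - j - 3 * m))"
  using assms
proof (induction n arbitrary: c rule: less_induct)
  case (less n)
  have "w n \<noteq> 0" using less.prems by simp
  then have nz: "n mod 7 = 4 \<or> n mod 7 = 6" unfolding w_eq_0_iff by blast
  show ?case
  proof (cases "c = 0")
    case True
    obtain q where "n = 7 * q + 4 \<or> n = 7 * q + 6" using nz by (metis mult_div_mod_eq)
    \<comment> \<open>With \<open>m = 1\<close> the new last letter is compared with position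
      \<open>n - 3\<close>, and \<open>n - 1\<close> with \<open>n - 4\<close>; the letter at
      \<open>n - 2\<close> is free, so 1 may stand there.\<close>
    then have "w (n - 3) = 0 \<and> w (n - 1) = 0 \<and> w (n - 1 - 3) = 0 \<and> 5 \<le> n + 1"
      using w_block[of q] by (auto simp: add.commute)
    moreover have "0 < j \<and> j < 2 * 1 \<longleftrightarrow> j = 1" for j :: nat by auto
    ultimately show ?thesis using True by (intro exI[of _ 1]) simp
  next
    case False
    have "n mod 7 \<noteq> 4"
    proof
      assume "n mod 7 = 4"
      then have "n = 7 * (n div 7) + 4" by presburger
      then show False using w_block(5)[of "n div 7"] less.prems False by simp
    qed
    then obtain q where n: "n = 7 * q + 6" using nz by (metis mult_div_mod_eq)
    have "c - 1 < w q" using less.prems False unfolding n w_block by simp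
    then obtain l where l: "l > 0" "5 * l \<le> q + 1" "w (q - 3 * l) = c - 1"
      and per: "\<And>j. 0 < j \<Longrightarrow> j < 2 * l \<Longrightarrow> w (q - j) = w (q - j - 3 * l)"
      using less.IH[of q "c - 1"] n by auto
    have "w (n - 3 * (7 * l)) = c"
    proof -
      have "n - 3 * (7 * l) = 7 * (q - 3 * l) + 6" using n l by simp
      then show ?thesis using l(3) False by (simp only: w_block)
    qed
    \<comment> \<open>If 7 divides \<open>j\<close>, both positions end a block and
      \<open>per\<close> applies; otherwise the letter depends only on the residue modulo 7. Since
      \<open>35 * l \<le> n + 1\<close>, no subtraction is truncated.\<close>
    moreover have "w (n - j) = w (n - j - 3 * (7 * l))" if j: "0 < j" "j < 2 * (7 * l)" for j
    proof (cases "7 dvd j")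
      case True
      then obtain h where h: "j = 7 * h" by blast
      have "n - j = 7 * (q - h) + 6" "n - j - 3 * (7 * l) = 7 * (q - h - 3 * l) + 6"
        using n l j h by linarith+
      then show ?thesis using per[of h] j h by (simp only: w_block)
    next
      case False
      have "n - j = n - j - 3 * (7 * l) + 7 * (3 * l)" using n l j by simp
      moreover have "(n - j - 3 * (7 * l)) mod 7 \<noteq> 6"
      proof
        assume "(n - j - 3 * (7 * l)) mod 7 = 6"
        then obtain p where "n - j - 3 * (7 * l) = 7 * p + 6" by (metis mult_div_mod_eq)
        then have "j = 7 * (q - p - 3 * l)" using n l j by simp
        then show False using False by simp
      qed
      ultimately show ?thesis using w_shift_cong by metis
    qed
    ultimately show ?thesis using l n by (intro exI[of _ "7 * l"]) simp
  qed
qed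

lemma power_free_w: "power_free 5 3 w"
  using ex_mismatch by (simp add: power_free_iff)

lemma is_lex_least_w: "is_lex_least (power_free 5 3) w"
  unfolding is_lex_least_def
proof (intro conjI allI impI power_free_w)
  fix x :: "nat word"
  assume x: "power_free 5 3 x"
  show "w = x \<or> less_fun w x"
  proof (cases "w = x")
    case False
    then have ex: "\<exists>n. w n \<noteq> x n" by auto
    define n where "n = (LEAST n. w n \<noteq> x n)"
    have n: "w n \<noteq> x n" unfolding n_def by (rule LeastI_ex[OF ex])
    have below: "w j = x j" if "j < n" for j
      using not_less_Least[of j "\<lambda>n. w n \<noteq> x n"] that unfolding n_def by blast
    have "\<not> x n < w n"
    proof
      assume "x n < w n"
      then obtain m where m: "m > 0" "5 * m \<le> n + 1" "w (n - 3 * m) = x n"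
        and per: "\<And>j. 0 < j \<Longrightarrow> j < 2 * m \<Longrightarrow> w (n - j) = w (n - j - 3 * m)"
        using ex_power_of_less by meson
      \<comment> \<open>The factor of length \<open>5 * m\<close> from \<open>i\<close> ends at
        \<open>n\<close>. Only the comparison \<open>k = 2 * m - 1\<close> reaches \<open>n\<close>;
        all others stay where \<open>x\<close> agrees with \<open>w\<close>.\<close>
      define i where "i = n + 1 - 5 * m"
      have "x (i + k) = x (i + k + 3 * m)" if k: "k < 2 * m" for k
      proof (cases "k = 2 * m - 1")
        case True
        then have "i + k = n - 3 * m" "i + k + 3 * m = n" using m k unfolding i_def by linarith+
        then show ?thesis using m below[of "n - 3 * m"] by simp
      next
        case False
        define j where "j = 2 * m - 1 - k"
        have "i + k + 3 * m = n - j" "i + k = n - j - 3 * m" "0 < j" "j < 2 * m" "n - j < n"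
          using False k m unfolding i_def j_def by linarith+
        then show ?thesis using per[of j] below[of "n - j"] below[of "n - j - 3 * m"] by simp
      qed
      moreover have "\<exists>k<2 * m. x (i + k) \<noteq> x (i + k + 3 * m)"
        using x m(1) by (simp add: power_free_iff)
      ultimately show False by blast
    qed
    then have "w n < x n" using n by simp
    then show ?thesis using below by (auto simp: less_fun_def)
  qed simp
qed

end

theorem theorem2p1:
  fixes \<phi> :: "nat \<Rightarrow> nat list"
  assumes "\<And>n. \<phi> n = [0, 0, 0, 0, 1, 0, n + 1]"
  shows "least_power_free_word 5 3 = morph_limit \<phi> 0"
proof -
  interpret word_five_thirds "morph_limit \<phi> 0"
  proof
    fix r q :: nat
    assume "r < 7"
    then show "morph_limit \<phi> 0 (7 * q + r) = [0, 0, 0, 0, 1, 0, morph_limit \<phi> 0 q + 1] ! r"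
      using morph_limit_fixed_point[of \<phi> 7 0 r q] by (simp add: assms)
  qed
  show ?thesis
    using is_lex_least_least_power_free_word[of 3 5] is_lex_least_w by (auto intro: is_lex_least_unique)
qed

end
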